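(* There exist forms $a,b,c\in\mathbb{R}[x,y,z]$ of degrees $2$, $3$, $4$, respectively, such that $ac-b^2\in P_{3,6}\setminus\Sigma_{3,6}$, i.e. the ternary sextic form $ac-b^2$ is nonnegative on $\mathbb{R}^3$ but is not a sum of squares of real polynomials.
   Context: A form is a homogeneous polynomial with real coefficients. $P_{n,2d}$ denotes the convex cone of forms of degree $2d$ in $n$ variables with real coefficients that are nonnegative on $\mathbb{R}^n$. $\Sigma_{n,2d}\subseteq P_{n,2d}$ denotes the subcone of forms that are sums of squares of real polynomials. *)

theory Defs
  imports "HOL-Analysis.Analysis" "HOL-Library.Poly_Mapping"
begin

text \<open>
  Real polynomials with one variable per element of the finite type \<open>'n\<close>: finitely supported
  functions from exponent vectors to coefficients, with the convolution product of
  \<^theory>\<open>HOL-Library.Poly_Mapping\<close>. The number \<open>n\<close> of variables is the cardinality of \<open>'n\<close>;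
  thus \<open>3 mpolynomial\<close> is the ring of polynomials in three variables.
\<close>

type_synonym 'n mpolynomial = "('n \<Rightarrow>\<^sub>0 nat) \<Rightarrow>\<^sub>0 real"

definition monom_degree :: "('n::finite \<Rightarrow>\<^sub>0 nat) \<Rightarrow> nat" where
  "monom_degree m = (\<Sum>i\<in>UNIV. Poly_Mapping.lookup m i)"

definition eval_mpoly :: "'n::finite mpolynomial \<Rightarrow> real ^ 'n \<Rightarrow> real" where
  "eval_mpoly p x =
     (\<Sum>m\<in>Poly_Mapping.keys p. Poly_Mapping.lookup p m * (\<Prod>i\<in>UNIV. (x $ i) ^ Poly_Mapping.lookup m i))"

text \<open>The zero polynomial is homogeneous of every degree, so that the sets below are convex cones.\<close>

definition homogeneous :: "nat \<Rightarrow> 'n::finite mpolynomial \<Rightarrow> bool" where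
  "homogeneous k p \<longleftrightarrow> (\<forall>m\<in>Poly_Mapping.keys p. monom_degree m = k)"

definition form_of_degree :: "nat \<Rightarrow> 'n::finite mpolynomial \<Rightarrow> bool" where
  "form_of_degree k p \<longleftrightarrow> p \<noteq> 0 \<and> homogeneous k p"

definition sum_of_squares :: "'n::finite mpolynomial \<Rightarrow> bool" where
  "sum_of_squares p \<longleftrightarrow> (\<exists>qs :: 'n mpolynomial list. p = (\<Sum>q\<leftarrow>qs. q\<^sup>2))"

text \<open>\<open>P\<^bsub>n,k\<^esub>\<close> and \<open>\<Sigma>\<^bsub>n,k\<^esub>\<close>, where \<open>k\<close> is the degree itself (usually written \<open>2d\<close>), not half of it.\<close>

definition psd_forms :: "nat \<Rightarrow> 'n::finite mpolynomial set" where
  "psd_forms k = {p. homogeneous k p \<and> (\<forall>x. 0 \<le> eval_mpoly p x)}"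

definition sos_forms :: "nat \<Rightarrow> 'n::finite mpolynomial set" where
  "sos_forms k = {p. homogeneous k p \<and> sum_of_squares p}"

end

theory Submission
  imports Defs "HOL-Computational_Algebra.Fundamental_Theorem_Algebra"
begin

text \<open>
  The example is \<open>f = a c - b\<^sup>2\<close> with \<open>a = x\<^sup>2 + y\<^sup>2 + z\<^sup>2\<close>, \<open>b = 4 z (x\<^sup>2 - y\<^sup>2)\<close> and
  \<open>c = (x\<^sup>2 + y\<^sup>2 - 2 z\<^sup>2)\<^sup>2 + 7 (x\<^sup>2 - y\<^sup>2)\<^sup>2\<close>.

  \<^emph>\<open>Nonnegativity.\<close> In terms of \<open>S = x\<^sup>2 + y\<^sup>2\<close>, \<open>D = (x\<^sup>2 - y\<^sup>2)\<^sup>2\<close> and \<open>Z = z\<^sup>2\<close> the form is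
  affine in \<open>D\<close>, namely \<open>f = (S + Z) ((S - 2 Z)\<^sup>2 + 7 D) - 16 Z D\<close>, and \<open>D\<close> ranges over \<open>[0, S\<^sup>2]\<close>.
  At \<open>D = 0\<close> its value is \<open>(S + Z) (S - 2 Z)\<^sup>2\<close>, and at \<open>D = S\<^sup>2\<close> it is \<open>4 (S - Z)\<^sup>2 (2 S + Z)\<close>; both
  are nonnegative. The coefficients \<open>7\<close> and \<open>16\<close> are the ones that give the second value
  a double zero at \<open>S = Z\<close>. Together the zeros \<open>S = 2 Z\<close> and \<open>S = Z\<close> of the two end values put
  zeros of \<open>f\<close> at \<open>(\<plusminus>1, \<plusminus>1, 1)\<close> and at \<open>(\<plusminus>1, 0, 1)\<close>, \<open>(0, \<plusminus>1, 1)\<close>, respectively.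

  \<^emph>\<open>No sum of squares.\<close> On the grid \<open>{(i, j, 1) | i, j \<in> {-1, 0, 1}}\<close> the form vanishes
  everywhere except at the centre \<open>(0, 0, 1)\<close>, where its value is \<open>4\<close>. In a representation
  \<open>f = \<Sum> q\<^sup>2\<close> each \<open>q\<close> agrees with a cubic form, since along every line \<open>t \<mapsto> t v\<close> it is
  bounded by a multiple of \<open>\<bar>t\<bar>\<^sup>3\<close>, near \<open>0\<close> as well as near infinity. The grid is the intersection of two cubics, \<open>x (x\<^sup>2 - z\<^sup>2) = 0\<close> and
  \<open>y (y\<^sup>2 - z\<^sup>2) = 0\<close>, and hence a cubic form that vanishes at eight of its points vanishes at the
  ninth (the theorem of Cayley and Bacharach). For this grid the linear relation behind the theorem
  is explicit: it is the second difference in \<open>x\<close> of the second difference in \<open>y\<close>, which annihilates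
  the polynomials in \<open>x, y\<close> of degree at most three. So every \<open>q\<close> vanishes at \<open>(0, 0, 1)\<close>, and so
  would \<open>f\<close>.
\<close>

section \<open>Evaluation of polynomials\<close>

lemma eval_mpoly_0 [simp]: "eval_mpoly 0 x = 0"
  by (simp add: eval_mpoly_def)

lemma eval_mpoly_add [simp]: "eval_mpoly (p + q) x = eval_mpoly p x + eval_mpoly q x"
  unfolding eval_mpoly_def by (rule setsum_keys_plus_distrib) (simp_all add: algebra_simps)

lemma eval_mpoly_uminus [simp]: "eval_mpoly (- p) x = - eval_mpoly p x"
proof -
  have "eval_mpoly (p + (- p)) x = 0" by simp
  then show ?thesis unfolding eval_mpoly_add by simp
qed

lemma eval_mpoly_diff [simp]: "eval_mpoly (p - q) x = eval_mpoly p x - eval_mpoly q x"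
  using eval_mpoly_add[of p "- q" x] by simp

lemma eval_mpoly_sum: "eval_mpoly (sum f A) x = (\<Sum>i\<in>A. eval_mpoly (f i) x)"
  by (induction A rule: infinite_finite_induct) auto

lemma eval_mpoly_single:
  "eval_mpoly (Poly_Mapping.single m r) x = r * (\<Prod>i\<in>UNIV. (x $ i) ^ Poly_Mapping.lookup m i)"
  by (simp add: eval_mpoly_def)

lemma poly_mapping_eq_sum_single:
  fixes p :: "'a \<Rightarrow>\<^sub>0 'b::comm_monoid_add"
  shows "p = (\<Sum>m\<in>Poly_Mapping.keys p. Poly_Mapping.single m (Poly_Mapping.lookup p m))"
proof (rule poly_mapping_eqI)
  fix k
  have "(\<Sum>m\<in>Poly_Mapping.keys p. Poly_Mapping.lookup p m when m = k) = Poly_Mapping.lookup p k"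
    by (cases "k \<in> Poly_Mapping.keys p") (auto simp: when_def in_keys_iff)
  then show "Poly_Mapping.lookup p k = Poly_Mapping.lookup
      (\<Sum>m\<in>Poly_Mapping.keys p. Poly_Mapping.single m (Poly_Mapping.lookup p m)) k"
    by (simp add: lookup_sum lookup_single)
qed

lemma eval_mpoly_mult [simp]: "eval_mpoly (p * q) x = eval_mpoly p x * eval_mpoly q x"
proof -
  let ?s = "\<lambda>p. \<Sum>m\<in>Poly_Mapping.keys p. Poly_Mapping.single m (Poly_Mapping.lookup p m)"
  have "eval_mpoly (?s p * ?s q) x = eval_mpoly (?s p) x * eval_mpoly (?s q) x"
    by (simp add: sum_product mult_single eval_mpoly_sum eval_mpoly_single lookup_add power_add
        prod.distrib mult_ac)
  then show ?thesis
    by (simp flip: poly_mapping_eq_sum_single)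
qed

lemma eval_mpoly_power2 [simp]: "eval_mpoly (p\<^sup>2) x = (eval_mpoly p x)\<^sup>2"
  by (simp add: power2_eq_square)

lemma eval_mpoly_sum_list: "eval_mpoly (sum_list ps) x = (\<Sum>p\<leftarrow>ps. eval_mpoly p x)"
  by (induction ps) auto

lemma eval_mpoly_numeral [simp]: "eval_mpoly (numeral n) x = numeral n"
  using eval_mpoly_single[of 0 "numeral n" x] by simp

definition mvar :: "'n \<Rightarrow> 'n::finite mpolynomial" where
  "mvar i = Poly_Mapping.single (Poly_Mapping.single i 1) 1"

lemma eval_mpoly_mvar [simp]: "eval_mpoly (mvar i) x = x $ i"
proof -
  have "(x $ j) ^ Poly_Mapping.lookup (Poly_Mapping.single i 1) j = (if j = i then x $ j else 1)" for j
    by (simp add: lookup_single)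
  then show ?thesis
    by (simp add: mvar_def eval_mpoly_single)
qed

section \<open>Homogeneous polynomials\<close>

lemma monom_degree_add: "monom_degree (m + n) = monom_degree m + monom_degree n"
  by (simp add: monom_degree_def lookup_add sum.distrib)

lemma homogeneous_add: "homogeneous k p \<Longrightarrow> homogeneous k q \<Longrightarrow> homogeneous k (p + q)"
  unfolding homogeneous_def using keys_add[of p q] by blast

lemma homogeneous_diff: "homogeneous k p \<Longrightarrow> homogeneous k q \<Longrightarrow> homogeneous k (p - q)"
  unfolding homogeneous_def using keys_diff[of p q] by blast

lemma homogeneous_mult: "homogeneous j p \<Longrightarrow> homogeneous k q \<Longrightarrow> homogeneous (j + k) (p * q)"
  unfolding homogeneous_def using keys_mult[of p q] by (fastforce simp: monom_degree_add)

lemma homogeneous_power2: "homogeneous k p \<Longrightarrow> homogeneous (2 * k) (p\<^sup>2)"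
  using homogeneous_mult[of k p k p] by (simp add: power2_eq_square mult_2)

lemma homogeneous_mvar: "homogeneous 1 (mvar i)"
proof -
  have "monom_degree (Poly_Mapping.single i 1) = (\<Sum>j\<in>UNIV. if i = j then 1 else 0)"
    unfolding monom_degree_def by (rule sum.cong) (auto simp: lookup_single when_def)
  then show ?thesis
    by (simp add: homogeneous_def mvar_def)
qed

lemma homogeneous_numeral_mult:
  assumes "homogeneous k p"
  shows "homogeneous k (numeral n * p)"
proof -
  have "homogeneous 0 (Poly_Mapping.single 0 (numeral n))"
    by (simp add: homogeneous_def monom_degree_def del: single_numeral)
  from homogeneous_mult[OF this assms] show ?thesis
    by simp
qed

lemma form_of_degree_if_eval_nonzero:
  "homogeneous k p \<Longrightarrow> eval_mpoly p x \<noteq> 0 \<Longrightarrow> form_of_degree k p"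
  by (auto simp: form_of_degree_def)

text \<open>
  Restricting a polynomial to the line through \<open>0\<close> and \<open>x\<close> gives a univariate polynomial whose
  coefficients are the values at \<open>x\<close> of the homogeneous components.
\<close>

definition ray_poly :: "'n::finite mpolynomial \<Rightarrow> real ^ 'n \<Rightarrow> real poly" where
  "ray_poly p x = (\<Sum>m\<in>Poly_Mapping.keys p.
     monom (Poly_Mapping.lookup p m * (\<Prod>i\<in>UNIV. (x $ i) ^ Poly_Mapping.lookup m i)) (monom_degree m))"

lemma poly_ray_poly: "poly (ray_poly p x) t = eval_mpoly p (t *\<^sub>R x)"
  by (simp add: ray_poly_def poly_sum poly_monom eval_mpoly_def monom_degree_def power_sum
      power_mult_distrib prod.distrib mult_ac)

lemma coeff_ray_poly:
  "coeff (ray_poly p x) k = (\<Sum>m | m \<in> Poly_Mapping.keys p \<and> monom_degree m = k.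
     Poly_Mapping.lookup p m * (\<Prod>i\<in>UNIV. (x $ i) ^ Poly_Mapping.lookup m i))"
  by (simp add: ray_poly_def coeff_sum sum.If_cases Int_def conj_commute)

lemma eval_mpoly_scale:
  assumes "homogeneous k p"
  shows "eval_mpoly p (t *\<^sub>R x) = t ^ k * eval_mpoly p x"
  using assms unfolding eval_mpoly_def homogeneous_def sum_distrib_left
  by (intro sum.cong refl)
    (auto simp: monom_degree_def power_sum power_mult_distrib prod.distrib mult_ac)

section \<open>The summands of a form that is a sum of squares\<close>

text \<open>
  The bound at \<open>0\<close> removes the terms of degree below \<open>d\<close>, and the bound at infinity those above.
\<close>

lemma poly_eq_monom_if_bounded:
  fixes p :: "real poly"
  assumes "\<And>t. t \<noteq> 0 \<Longrightarrow> \<bar>poly p t\<bar> \<le> C * \<bar>t\<bar> ^ d"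
  shows "\<exists>c. p = monom c d"
  using assms
proof (induction d arbitrary: p)
  case 0
  obtain a q where p: "p = pCons a q"
    by (cases p)
  have "q = 0"
  proof (rule ccontr)
    assume "q \<noteq> 0"
    from poly_infinity[OF this] obtain r where
      r: "\<forall>t. r \<le> norm t \<longrightarrow> C + 1 \<le> norm (poly (pCons a q) t)"
      by blast
    have "C + 1 \<le> \<bar>poly p (max 1 r)\<bar>"
      using r[rule_format, of "max 1 r"] by (simp add: p)
    also have "\<dots> \<le> C"
      using "0.prems"[of "max 1 r"] by simp
    finally show False by simp
  qed
  then show ?case
    using p by (auto simp: monom_0)
next
  case (Suc d)
  have "((\<lambda>t. C * \<bar>t\<bar> ^ Suc d) \<longlongrightarrow> C * \<bar>0\<bar> ^ Suc d) (at 0)"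
    by (intro tendsto_intros)
  then have "((\<lambda>t. C * \<bar>t\<bar> ^ Suc d) \<longlongrightarrow> 0) (at 0)"
    by simp
  moreover have "\<forall>\<^sub>F t in at 0. norm (poly p t) \<le> C * \<bar>t\<bar> ^ Suc d"
    unfolding eventually_at_filter using Suc.prems by (intro always_eventually) simp
  ultimately have "(poly p \<longlongrightarrow> 0) (at 0)"
    by (rule Lim_null_comparison[rotated])
  moreover have "(poly p \<longlongrightarrow> poly p 0) (at 0)"
    using poly_isCont[of 0 p] by (simp add: isCont_def)
  ultimately have "poly p 0 = 0"
    by (rule LIM_unique[rotated])
  then obtain q where p: "p = pCons 0 q"
    by (cases p) auto
  have "\<bar>poly q t\<bar> \<le> C * \<bar>t\<bar> ^ d" if "t \<noteq> 0" for t
    using Suc.prems[OF that] that by (simp add: p abs_mult mult.left_commute)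
  from Suc.IH[OF this] obtain c where "q = monom c d"
    by blast
  then show ?case
    by (auto simp: p monom_Suc)
qed

text \<open>
  Since \<open>q\<^sup>2\<close> is one of the nonnegative terms that add up to \<open>p\<close>, it satisfies
  \<open>q(t x)\<^sup>2 \<le> p(t x) = t\<^bsup>2d\<^esup> p(x)\<close>, which leaves only the component of degree \<open>d\<close>.
\<close>

lemma eval_summand_eq_component:
  assumes hom: "homogeneous (2 * d) p" and sos: "p = (\<Sum>q\<leftarrow>qs. q\<^sup>2)" and q: "q \<in> set qs"
  shows "eval_mpoly q x = (\<Sum>m | m \<in> Poly_Mapping.keys q \<and> monom_degree m = d.
     Poly_Mapping.lookup q m * (\<Prod>i\<in>UNIV. (x $ i) ^ Poly_Mapping.lookup m i))"
proof -
  have le: "(eval_mpoly q y)\<^sup>2 \<le> eval_mpoly p y" for y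
  proof -
    have "(eval_mpoly q y)\<^sup>2 \<in> set (map (\<lambda>q. (eval_mpoly q y)\<^sup>2) qs)"
      using q by simp
    then have "(eval_mpoly q y)\<^sup>2 \<le> (\<Sum>q\<leftarrow>qs. (eval_mpoly q y)\<^sup>2)"
      by (rule member_le_sum_list) auto
    also have "\<dots> = eval_mpoly p y"
      by (simp add: sos eval_mpoly_sum_list o_def)
    finally show ?thesis .
  qed
  have "\<bar>poly (ray_poly q x) t\<bar> \<le> sqrt (eval_mpoly p x) * \<bar>t\<bar> ^ d" for t
  proof -
    have "\<bar>eval_mpoly q (t *\<^sub>R x)\<bar> \<le> sqrt (eval_mpoly p (t *\<^sub>R x))"
      using le by (simp add: real_le_rsqrt)
    also have "\<dots> = sqrt ((\<bar>t\<bar> ^ d)\<^sup>2 * eval_mpoly p x)"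
    proof -
      have "t ^ (2 * d) = (\<bar>t\<bar> ^ d)\<^sup>2"
        by (simp only: power_even_eq power_abs[symmetric] abs_power2)
      then show ?thesis
        by (simp only: eval_mpoly_scale[OF hom])
    qed
    also have "\<dots> = sqrt (eval_mpoly p x) * \<bar>t\<bar> ^ d"
      by (simp add: real_sqrt_mult)
    finally show ?thesis
      by (simp add: poly_ray_poly)
  qed
  then obtain c where c: "ray_poly q x = monom c d"
    using poly_eq_monom_if_bounded by blast
  have "eval_mpoly q x = poly (ray_poly q x) 1"
    by (simp add: poly_ray_poly)
  also have "\<dots> = coeff (ray_poly q x) d"
    by (simp add: c poly_monom)
  finally show ?thesis
    by (simp add: coeff_ray_poly)
qed

section \<open>The Cayley--Bacharach relation on the grid\<close>

text \<open>
  The second difference of \<open>t\<^sup>k\<close> over \<open>{-1, 0, 1}\<close> vanishes for \<open>k < 2\<close>, and a monomial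
  \<open>x\<^sup>i y\<^sup>j\<close> with \<open>i + j \<le> 3\<close> has \<open>i < 2\<close> or \<open>j < 2\<close>.
\<close>

lemma grid_relation_monomial:
  fixes w :: "real \<Rightarrow> real"
  defines "w \<equiv> \<lambda>t. if t = 0 then - 2 else 1"
  assumes "i + j \<le> (3::nat)"
  shows "(\<Sum>s\<in>{- 1, 0, 1}. \<Sum>t\<in>{- 1, 0, 1}. w s * w t * (s ^ i * t ^ j)) = 0"
proof -
  have second_difference: "(\<Sum>t\<in>{- 1, 0, 1}. w t * t ^ k) = 0" if "k = 0 \<or> k = 1" for k :: nat
    using that by (auto simp: w_def)
  have "(\<Sum>s\<in>{- 1, 0, 1}. \<Sum>t\<in>{- 1, 0, 1}. w s * w t * (s ^ i * t ^ j)) =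
        (\<Sum>s\<in>{- 1, 0, 1}. w s * s ^ i) * (\<Sum>t\<in>{- 1, 0, 1}. w t * t ^ j)"
    unfolding sum_product by (intro sum.cong refl) (simp only: mult_ac)
  moreover have "i = 0 \<or> i = 1 \<or> j = 0 \<or> j = 1"
    using assms(2) by linarith
  then have "(\<Sum>s\<in>{- 1, 0, 1}. w s * s ^ i) = 0 \<or> (\<Sum>t\<in>{- 1, 0, 1}. w t * t ^ j) = 0"
    using second_difference by blast
  ultimately show ?thesis
    by (simp only: mult_eq_0_iff)
qed

lemma cubic_vanishes_at_grid_centre:
  fixes K :: "(3 \<Rightarrow>\<^sub>0 nat) set" and r :: "(3 \<Rightarrow>\<^sub>0 nat) \<Rightarrow> real"
  defines "g \<equiv> \<lambda>x y. \<Sum>m\<in>K. r m * (\<Prod>i\<in>UNIV. ((vector [x, y, 1] :: real ^ 3) $ i) ^ Poly_Mapping.lookup m i)"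
  assumes deg: "\<And>m. m \<in> K \<Longrightarrow> monom_degree m = 3"
    and zero: "\<And>s t. s \<in> {- 1, 0, 1} \<Longrightarrow> t \<in> {- 1, 0, 1} \<Longrightarrow> (s, t) \<noteq> (0, 0) \<Longrightarrow> g s t = 0"
  shows "g 0 0 = 0"
proof -
  define G :: "real set" where "G = {- 1, 0, 1}"
  define w :: "real \<Rightarrow> real" where "w = (\<lambda>t. if t = 0 then - 2 else 1)"
  define h :: "real \<Rightarrow> real \<Rightarrow> (3 \<Rightarrow>\<^sub>0 nat) \<Rightarrow> real"
    where "h = (\<lambda>x y m. x ^ Poly_Mapping.lookup m 1 * y ^ Poly_Mapping.lookup m 2)"
  have g: "g x y = (\<Sum>m\<in>K. r m * h x y m)" for x y
    unfolding g_def h_def UNIV_3 by (simp add: mult_ac)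
  have "4 * g 0 0 = (\<Sum>s\<in>G. \<Sum>t\<in>G. w s * w t * g s t)"
    using zero by (simp add: G_def w_def)
  also have "\<dots> = (\<Sum>s\<in>G. \<Sum>t\<in>G. \<Sum>m\<in>K. r m * (w s * w t * h s t m))"
    unfolding g sum_distrib_left by (intro sum.cong refl) (simp only: mult_ac)
  also have "\<dots> = (\<Sum>m\<in>K. r m * (\<Sum>s\<in>G. \<Sum>t\<in>G. w s * w t * h s t m))"
    by (simp only: sum.swap[where A = G and B = K] sum_distrib_left)
  also have "\<dots> = 0"
  proof (intro sum.neutral ballI)
    fix m assume "m \<in> K"
    then have "Poly_Mapping.lookup m 1 + Poly_Mapping.lookup m 2 \<le> 3"
      using deg[of m] by (simp add: monom_degree_def sum_3)
    from grid_relation_monomial[OF this]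
    show "r m * (\<Sum>s\<in>G. \<Sum>t\<in>G. w s * w t * h s t m) = 0"
      by (simp only: G_def w_def h_def mult_zero_right)
  qed
  finally show ?thesis
    by simp
qed

lemma not_sos_if_nonzero_only_at_grid_centre:
  fixes p :: "3 mpolynomial"
  assumes hom: "homogeneous 6 p"
    and zero: "\<And>s t. s \<in> {- 1, 0, 1} \<Longrightarrow> t \<in> {- 1, 0, 1} \<Longrightarrow> (s, t) \<noteq> (0, 0) \<Longrightarrow>
                 eval_mpoly p (vector [s, t, 1]) = 0"
    and centre: "eval_mpoly p (vector [0, 0, 1]) \<noteq> 0"
  shows "\<not> sum_of_squares p"
proof
  assume "sum_of_squares p"
  then obtain qs where sos: "p = (\<Sum>q\<leftarrow>qs. q\<^sup>2)"
    by (auto simp: sum_of_squares_def)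
  have eval_p: "eval_mpoly p x = (\<Sum>q\<leftarrow>qs. (eval_mpoly q x)\<^sup>2)" for x
    by (simp add: sos eval_mpoly_sum_list o_def)
  have "eval_mpoly q (vector [0, 0, 1]) = 0" if q: "q \<in> set qs" for q
  proof -
    have component: "eval_mpoly q x = (\<Sum>m | m \<in> Poly_Mapping.keys q \<and> monom_degree m = 3.
        Poly_Mapping.lookup q m * (\<Prod>i\<in>UNIV. (x $ i) ^ Poly_Mapping.lookup m i))" for x
      by (rule eval_summand_eq_component[OF _ sos q]) (simp add: hom)
    have "eval_mpoly q (vector [s, t, 1]) = 0"
      if "s \<in> {- 1, 0, 1}" "t \<in> {- 1, 0, 1}" "(s, t) \<noteq> (0, 0)" for s t
    proof -
      have "(\<Sum>q\<leftarrow>qs. (eval_mpoly q (vector [s, t, 1]))\<^sup>2) = 0"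
        using zero[OF that] by (simp add: eval_p)
      then show ?thesis
        using q by (subst (asm) sum_list_nonneg_eq_0_iff) auto
    qed
    then show ?thesis
      unfolding component by (intro cubic_vanishes_at_grid_centre) auto
  qed
  then have "map (\<lambda>q. (eval_mpoly q (vector [0, 0, 1]))\<^sup>2) qs = map (\<lambda>q. 0) qs"
    by simp
  then have "eval_mpoly p (vector [0, 0, 1]) = 0"
    unfolding eval_p by (simp only: sum_list_0)
  with centre show False ..
qed

section \<open>The example\<close>

lemma sextic_nonneg:
  fixes x y z :: real
  shows "0 \<le> (x\<^sup>2 + y\<^sup>2 + z\<^sup>2) * ((x\<^sup>2 + y\<^sup>2 - 2 * z\<^sup>2)\<^sup>2 + 7 * (x\<^sup>2 - y\<^sup>2)\<^sup>2) - (4 * (z * (x\<^sup>2 - y\<^sup>2)))\<^sup>2"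
    (is "0 \<le> ?f")
proof (cases "x\<^sup>2 + y\<^sup>2 = 0")
  case True
  then show ?thesis by simp
next
  case False
  then have pos: "0 < (x\<^sup>2 + y\<^sup>2)\<^sup>2" by simp
  \<comment> \<open>The form is affine in \<open>D = (X - Y)\<^sup>2\<close>; it is interpolated between its values at \<open>D = 0\<close> and
    \<open>D = (X + Y)\<^sup>2\<close>, with weights \<open>(X + Y)\<^sup>2 - D = 4 X Y\<close> and \<open>D\<close>.\<close>
  have "(X + Y)\<^sup>2 * ((X + Y + Z) * ((X + Y - 2 * Z)\<^sup>2 + 7 * (X - Y)\<^sup>2) - 16 * (Z * (X - Y)\<^sup>2)) =
      4 * X * Y * ((X + Y + Z) * (X + Y - 2 * Z)\<^sup>2) +
      (X - Y)\<^sup>2 * (4 * (X + Y - Z)\<^sup>2 * (2 * (X + Y) + Z))" for X Y Z :: real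
    by (simp add: power2_eq_square algebra_simps)
  from this[of "x\<^sup>2" "y\<^sup>2" "z\<^sup>2"]
  have "(x\<^sup>2 + y\<^sup>2)\<^sup>2 * ?f =
      4 * x\<^sup>2 * y\<^sup>2 * ((x\<^sup>2 + y\<^sup>2 + z\<^sup>2) * (x\<^sup>2 + y\<^sup>2 - 2 * z\<^sup>2)\<^sup>2) +
      (x\<^sup>2 - y\<^sup>2)\<^sup>2 * (4 * (x\<^sup>2 + y\<^sup>2 - z\<^sup>2)\<^sup>2 * (2 * (x\<^sup>2 + y\<^sup>2) + z\<^sup>2))"
    by (simp add: power_mult_distrib)
  also have "0 \<le> \<dots>"
    by (intro add_nonneg_nonneg mult_nonneg_nonneg) auto
  finally show ?thesis
    using mult_le_cancel_left_pos[OF pos, of 0 ?f] by (simp only: mult_zero_right)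
qed

theorem theorem3:
  "\<exists>a b c :: 3 mpolynomial.
     form_of_degree 2 a \<and> form_of_degree 3 b \<and> form_of_degree 4 c \<and>
     a * c - b\<^sup>2 \<in> psd_forms 6 - sos_forms 6"
proof -
  let ?x = "mvar 1 :: 3 mpolynomial" and ?y = "mvar 2 :: 3 mpolynomial"
    and ?z = "mvar 3 :: 3 mpolynomial"
  define a where "a = ?x\<^sup>2 + ?y\<^sup>2 + ?z\<^sup>2"
  define b where "b = 4 * (?z * (?x\<^sup>2 - ?y\<^sup>2))"
  define c where "c = (?x\<^sup>2 + ?y\<^sup>2 - 2 * ?z\<^sup>2)\<^sup>2 + 7 * (?x\<^sup>2 - ?y\<^sup>2)\<^sup>2"
  have sq: "homogeneous 2 ((mvar i)\<^sup>2)" for i :: 3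
    using homogeneous_power2[OF homogeneous_mvar] by simp
  have ha: "homogeneous 2 a"
    unfolding a_def by (intro homogeneous_add sq)
  have "homogeneous (1 + 2) b"
    unfolding b_def
    by (intro homogeneous_numeral_mult homogeneous_mult homogeneous_mvar homogeneous_diff sq)
  moreover have "1 + 2 = (3::nat)" by simp
  ultimately have hb: "homogeneous 3 b" by (simp only:)
  have "homogeneous (2 * 2) c"
    unfolding c_def by (intro homogeneous_add homogeneous_numeral_mult homogeneous_power2
        homogeneous_diff sq)
  then have hc: "homogeneous 4 c" by simp
  have hf: "homogeneous 6 (a * c - b\<^sup>2)"
    using homogeneous_diff[OF _ homogeneous_power2[OF hb]] homogeneous_mult[OF ha hc] by simp
  have eval_f: "eval_mpoly (a * c - b\<^sup>2) v =
      ((v $ 1)\<^sup>2 + (v $ 2)\<^sup>2 + (v $ 3)\<^sup>2) *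
        (((v $ 1)\<^sup>2 + (v $ 2)\<^sup>2 - 2 * (v $ 3)\<^sup>2)\<^sup>2 + 7 * ((v $ 1)\<^sup>2 - (v $ 2)\<^sup>2)\<^sup>2) -
        (4 * (v $ 3 * ((v $ 1)\<^sup>2 - (v $ 2)\<^sup>2)))\<^sup>2" for v
    by (simp add: a_def b_def c_def)
  have "form_of_degree 2 a"
    using ha by (rule form_of_degree_if_eval_nonzero[where x = "vector [1, 0, 1]"]) (simp add: a_def)
  moreover have "form_of_degree 3 b"
    using hb by (rule form_of_degree_if_eval_nonzero[where x = "vector [1, 0, 1]"]) (simp add: b_def)
  moreover have "form_of_degree 4 c"
    using hc by (rule form_of_degree_if_eval_nonzero[where x = "vector [1, 0, 1]"]) (simp add: c_def)
  moreover have "a * c - b\<^sup>2 \<in> psd_forms 6"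
    unfolding psd_forms_def mem_Collect_eq eval_f using hf sextic_nonneg by blast
  moreover have "\<not> sum_of_squares (a * c - b\<^sup>2)"
    by (rule not_sos_if_nonzero_only_at_grid_centre[OF hf]) (auto simp: a_def b_def c_def)
  then have "a * c - b\<^sup>2 \<notin> sos_forms 6"
    by (simp add: sos_forms_def)
  ultimately show ?thesis
    by blast
qed

end
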